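(* Let $n\ge2$ and let $\varepsilon_D(n)>0$, $C_D(n)<\infty$ be constants (independent of the codimension) having the fixed-scale comparison property stated in the context. After decreasing $\varepsilon_D(n)$ (to another positive constant depending only on $n$, with $C_D$ unchanged), the following holds for every $k\ge1$, $\mathfrak m=n+k$. Let $q\in\mathbb H^{\mathfrak m}$, let $L\cong\mathbb H^n$ be a totally geodesic subspace of $\mathbb H^{\mathfrak m}$, and let $V$ be an integral $n$-varifold in $B_2(q)$. Suppose that $\operatorname{dist}_{\mathbb H}(q,L)<\varepsilon_D$, that $V$ is stationary in $B_2(q)$, and that $$\operatorname{supp}V\cap B_2(q)\subset\{\operatorname{dist}_{\mathbb H}(\cdot,L)<\varepsilon_D\}.$$ Then $$\mu_V(B_1(q))\le C_D\,\mu_V(B_{1/2}(q)).$$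
   Context: $\mathbb H^{\mathfrak m}$ is hyperbolic space of constant curvature $-1$; $B_s(q)$ is the open hyperbolic ball of radius $s$ about $q$ in $\mathbb H^{\mathfrak m}$. An integral $n$-varifold $V$ in an open set $U$ is the Radon measure on the Grassmann bundle $G_n(U)$ induced by a countably $n$-rectifiable set with integer-valued density; $\mu_V=\|V\|$ is its weight measure and $\operatorname{supp}V$ the support of $\mu_V$. $V$ is stationary in $U$ if $\int_{G_n(U)}\operatorname{div}_SX\,dV(x,S)=0$ for every compactly supported $C^1$ vector field $X$ on $U$. Fixed-scale comparison property of $(\varepsilon_D,C_D)$: for every $k\ge1$, $\mathfrak m=n+k$, every totally geodesic $L\cong\mathbb H^n\subset\mathbb H^{\mathfrak m}$, every $p\in L$ and every stationary integral $n$-varifold $V$ in $B_{3/2}(p)$ with $\operatorname{supp}V\cap B_{3/2}(p)\subset\{\operatorname{dist}_{\mathbb H}(\cdot,L)<\varepsilon_D\}$, one has $\mu_V(B_{5/4}(p))\le C_D\,\mu_V(B_{1/4}(p))$. (The paper proves that such constants depending only on $n$ exist.) *)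

theory Defs
  imports "HOL-Analysis.Analysis"
begin

section \<open>Hyperbolic space\<close>

text \<open>
  The dimension is quantified over inside the statement, so it has to be a term. Hyperbolic
  \<open>m\<close>-space of curvature \<open>-1\<close> is the upper sheet of the hyperboloid in Minkowski space
  \<open>\<real>\<^sup>m\<^sup>,\<^sup>1\<close>, whose vectors are the functions \<open>nat \<Rightarrow> real\<close> supported in \<open>{0..m}\<close>, index \<open>0\<close> being
  the time coordinate. The topology is the one induced by the product topology of
  \<open>nat \<Rightarrow> real\<close>; on the hyperboloid it agrees with the topology of \<open>hdist\<close>.
\<close>

definition lor :: "nat \<Rightarrow> (nat \<Rightarrow> real) \<Rightarrow> (nat \<Rightarrow> real) \<Rightarrow> real" where
  "lor m x y = (\<Sum>i=1..m. x i * y i) - x 0 * y 0"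

definition hyp :: "nat \<Rightarrow> (nat \<Rightarrow> real) set" where
  "hyp m = {x \<in> topspace (Euclidean_space (Suc m)). lor m x x = -1 \<and> 0 < x 0}"

definition hdist :: "nat \<Rightarrow> (nat \<Rightarrow> real) \<Rightarrow> (nat \<Rightarrow> real) \<Rightarrow> real" where
  "hdist m x y = arcosh (- lor m x y)"

definition hball :: "nat \<Rightarrow> (nat \<Rightarrow> real) \<Rightarrow> real \<Rightarrow> (nat \<Rightarrow> real) set" where
  "hball m q s = {x \<in> hyp m. hdist m q x < s}"

definition hsetdist :: "nat \<Rightarrow> (nat \<Rightarrow> real) \<Rightarrow> (nat \<Rightarrow> real) set \<Rightarrow> real" where
  "hsetdist m x L = (INF y\<in>L. hdist m x y)"

text \<open>On each tangent space the form \<open>lor m\<close> is positive definite: it is the Riemannian metric.\<close>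

definition tangent :: "nat \<Rightarrow> (nat \<Rightarrow> real) \<Rightarrow> (nat \<Rightarrow> real) set" where
  "tangent m x = {v \<in> topspace (Euclidean_space (Suc m)). lor m x v = 0}"

text \<open>The unit-speed geodesic through \<open>x\<close> with initial velocity the unit tangent vector \<open>v\<close>.\<close>

definition geodesic :: "(nat \<Rightarrow> real) \<Rightarrow> (nat \<Rightarrow> real) \<Rightarrow> real \<Rightarrow> nat \<Rightarrow> real" where
  "geodesic x v t = (\<lambda>i. cosh t * x i + sinh t * v i)"

text \<open>
  \<open>L\<close> is a (complete) totally geodesic subspace of \<open>hyp m\<close> with \<open>L \<cong> hyp n\<close>: it contains the whole
  geodesic through any two of its points, and it is isometric to \<open>hyp n\<close>.
\<close>

definition totally_geodesic :: "nat \<Rightarrow> nat \<Rightarrow> (nat \<Rightarrow> real) set \<Rightarrow> bool" where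
  "totally_geodesic n m L \<longleftrightarrow>
     L \<subseteq> hyp m \<and>
     (\<forall>x\<in>L. \<forall>v\<in>tangent m x. lor m v v = 1 \<longrightarrow> (\<exists>t. t \<noteq> 0 \<and> geodesic x v t \<in> L) \<longrightarrow>
        (\<forall>t. geodesic x v t \<in> L)) \<and>
     (\<exists>f. bij_betw f (hyp n) L \<and> (\<forall>x\<in>hyp n. \<forall>y\<in>hyp n. hdist m (f x) (f y) = hdist n x y))"


section \<open>Hausdorff measure and rectifiable sets\<close>

definition hdiam :: "nat \<Rightarrow> (nat \<Rightarrow> real) set \<Rightarrow> ennreal" where
  "hdiam m C = (SUP x\<in>C. SUP y\<in>C. ennreal (hdist m x y))"

definition hausdorff_pre :: "nat \<Rightarrow> nat \<Rightarrow> real \<Rightarrow> (nat \<Rightarrow> real) set \<Rightarrow> ennreal" where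
  "hausdorff_pre n m \<delta> A =
     (INF C \<in> {C :: nat \<Rightarrow> (nat \<Rightarrow> real) set.
                 (\<forall>i. C i \<subseteq> hyp m \<and> hdiam m (C i) \<le> ennreal \<delta>) \<and> A \<subseteq> (\<Union>i. C i)}.
        \<Sum>i. ennreal (unit_ball_vol (real n)) * (hdiam m (C i) / 2) ^ n)"

definition hausdorff_outer :: "nat \<Rightarrow> nat \<Rightarrow> (nat \<Rightarrow> real) set \<Rightarrow> ennreal" where
  "hausdorff_outer n m A = (SUP \<delta>\<in>{0<..}. hausdorff_pre n m \<delta> A)"

text \<open>The \<open>n\<close>-dimensional Hausdorff measure of \<open>hyp m\<close> on its Caratheodory-measurable sets.\<close>

definition hausdorff :: "nat \<Rightarrow> nat \<Rightarrow> (nat \<Rightarrow> real) measure" where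
  "hausdorff n m =
     measure_of (hyp m) (lambda_system (hyp m) (Pow (hyp m)) (hausdorff_outer n m))
       (hausdorff_outer n m)"

definition lipschitz_map :: "nat \<Rightarrow> nat \<Rightarrow> ((nat \<Rightarrow> real) \<Rightarrow> nat \<Rightarrow> real) \<Rightarrow> bool" where
  "lipschitz_map n m f \<longleftrightarrow>
     f \<in> topspace (Euclidean_space n) \<rightarrow> hyp m \<and>
     (\<exists>B. \<forall>y\<in>topspace (Euclidean_space n). \<forall>z\<in>topspace (Euclidean_space n).
        hdist m (f y) (f z) \<le> B * L2_set (\<lambda>i. y i - z i) {..<n})"

definition countably_rectifiable :: "nat \<Rightarrow> nat \<Rightarrow> (nat \<Rightarrow> real) set \<Rightarrow> bool" where
  "countably_rectifiable n m M \<longleftrightarrow>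
     (\<exists>N f. N \<subseteq> hyp m \<and> hausdorff_outer n m N = 0 \<and> (\<forall>j::nat. lipschitz_map n m (f j)) \<and>
        M \<subseteq> N \<union> (\<Union>j. f j ` topspace (Euclidean_space n)))"

text \<open>
  The approximate tangent cone (Federer 3.2.16) of the restriction of the Hausdorff measure to \<open>M\<close>:
  the vectors \<open>v\<close> all of whose conical neighbourhoods with vertex \<open>x\<close> meet \<open>M\<close> in a set of positive
  upper density at \<open>x\<close>. If \<open>M\<close> is measurable, countably \<open>n\<close>-rectifiable and of locally finite measure,
  then at almost every \<open>x \<in> M\<close> it is the \<open>n\<close>-dimensional approximate tangent space of \<open>M\<close>.
\<close>

definition cone_nbhd :: "nat \<Rightarrow> (nat \<Rightarrow> real) \<Rightarrow> (nat \<Rightarrow> real) \<Rightarrow> real \<Rightarrow> (nat \<Rightarrow> real) set" where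
  "cone_nbhd m x v \<epsilon> = {y \<in> hyp m. \<exists>r>0. L2_set (\<lambda>i. r * (y i - x i) - v i) {..m} < \<epsilon>}"

definition approx_tangent ::
  "nat \<Rightarrow> nat \<Rightarrow> (nat \<Rightarrow> real) set \<Rightarrow> (nat \<Rightarrow> real) \<Rightarrow> (nat \<Rightarrow> real) set" where
  "approx_tangent n m M x =
     {v \<in> tangent m x. \<forall>\<epsilon>>0.
        0 < Limsup (at_right 0) (\<lambda>r. hausdorff_outer n m (M \<inter> cone_nbhd m x v \<epsilon> \<inter> hball m x r)
                                     / ennreal (unit_ball_vol (real n) * r ^ n))}"


section \<open>The Grassmann bundle\<close>

text \<open>An \<open>n\<close>-dimensional subspace of a tangent space is given as the span of an orthonormal basis.\<close>

definition orthonormal_frame :: "nat \<Rightarrow> nat \<Rightarrow> (nat \<Rightarrow> real) \<Rightarrow> (nat \<Rightarrow> nat \<Rightarrow> real) \<Rightarrow> bool" where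
  "orthonormal_frame n m x e \<longleftrightarrow>
     (\<forall>i<n. e i \<in> tangent m x) \<and>
     (\<forall>i<n. \<forall>j<n. lor m (e i) (e j) = (if i = j then 1 else 0))"

definition frame_span :: "nat \<Rightarrow> (nat \<Rightarrow> nat \<Rightarrow> real) \<Rightarrow> (nat \<Rightarrow> real) set" where
  "frame_span n e = {\<lambda>j. \<Sum>i<n. a i * e i j | a :: nat \<Rightarrow> real. True}"

definition grassmann :: "nat \<Rightarrow> nat \<Rightarrow> (nat \<Rightarrow> real) set \<Rightarrow> ((nat \<Rightarrow> real) \<times> (nat \<Rightarrow> real) set) set" where
  "grassmann n m U = {(x, S). x \<in> U \<and> (\<exists>e. orthonormal_frame n m x e \<and> S = frame_span n e)}"

definition lor_proj :: "nat \<Rightarrow> (nat \<Rightarrow> real) set \<Rightarrow> (nat \<Rightarrow> real) \<Rightarrow> nat \<Rightarrow> real" where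
  "lor_proj m S v = (THE w. w \<in> S \<and> (\<forall>u\<in>S. lor m (\<lambda>i. v i - w i) u = 0))"

text \<open>
  The Borel sets of the Grassmann bundle: as usual a plane is identified with (the matrix of) the
  orthogonal projection onto it, which embeds the bundle topologically into a space of vectors and
  matrices.
\<close>

definition grassmann_borel ::
  "nat \<Rightarrow> nat \<Rightarrow> (nat \<Rightarrow> real) set \<Rightarrow> ((nat \<Rightarrow> real) \<times> (nat \<Rightarrow> real) set) measure" where
  "grassmann_borel n m U =
     vimage_algebra (grassmann n m U)
       (\<lambda>(x, S). (x, \<lambda>j. lor_proj m S (\<lambda>i. if i = j then 1 else 0)))
       (borel :: ((nat \<Rightarrow> real) \<times> (nat \<Rightarrow> nat \<Rightarrow> real)) measure)"


section \<open>Varifolds\<close>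

type_synonym varifold = "((nat \<Rightarrow> real) \<times> (nat \<Rightarrow> real) set) measure"

text \<open>
  The local integrability of the density is what makes the measure Radon: compact sets of the bundle
  are those lying over compact sets of the base, up to closed subsets.
\<close>

definition integral_varifold :: "nat \<Rightarrow> nat \<Rightarrow> (nat \<Rightarrow> real) set \<Rightarrow> varifold \<Rightarrow> bool" where
  "integral_varifold n m U V \<longleftrightarrow>
     sets V = sets (grassmann_borel n m U) \<and>
     (\<exists>M (\<theta> :: (nat \<Rightarrow> real) \<Rightarrow> nat).
        M \<subseteq> U \<and> M \<in> sets (hausdorff n m) \<and> countably_rectifiable n m M \<and>
        \<theta> \<in> restrict_space (hausdorff n m) M \<rightarrow>\<^sub>M count_space UNIV \<and> (\<forall>x\<in>M. 1 \<le> \<theta> x) \<and>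
        (\<forall>K. compact K \<longrightarrow> K \<subseteq> U \<longrightarrow> (\<integral>\<^sup>+x\<in>M \<inter> K. of_nat (\<theta> x) \<partial>hausdorff n m) < \<infinity>) \<and>
        (\<forall>A\<in>sets (grassmann_borel n m U).
           emeasure V A =
             (\<integral>\<^sup>+x\<in>{x \<in> M. (x, approx_tangent n m M x) \<in> A}. of_nat (\<theta> x) \<partial>hausdorff n m)))"

definition weight :: "varifold \<Rightarrow> (nat \<Rightarrow> real) measure" where
  "weight V = distr V borel fst"

definition varifold_supp :: "nat \<Rightarrow> varifold \<Rightarrow> (nat \<Rightarrow> real) set" where
  "varifold_supp m V = {x \<in> hyp m. \<forall>r>0. 0 < emeasure (weight V) (hball m x r)}"

text \<open>
  The inverse of the global chart \<open>x \<mapsto> (x\<^sub>1, \<dots>, x\<^sub>m)\<close> of the hyperboloid; the coordinate \<open>y 0\<close> of the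
  argument is ignored.
\<close>

definition lift :: "nat \<Rightarrow> (nat \<Rightarrow> real) \<Rightarrow> nat \<Rightarrow> real" where
  "lift m y = (\<lambda>i. if i = 0 then sqrt (1 + (\<Sum>j=1..m. (y j)\<^sup>2)) else y i)"

text \<open>\<open>C\<^sup>1\<close> functions on \<open>hyp m\<close>: those with continuous partial derivatives in this chart.\<close>

definition C1_fun :: "nat \<Rightarrow> ((nat \<Rightarrow> real) \<Rightarrow> real) \<Rightarrow> bool" where
  "C1_fun m f \<longleftrightarrow>
     (\<forall>i\<in>{1..m}. \<exists>g. continuous_on (hyp m) g \<and>
        (\<forall>x\<in>hyp m. ((\<lambda>t. f (lift m (x(i := t)))) has_real_derivative g x) (at (x i))))"

text \<open>Compactly supported \<open>C\<^sup>1\<close> vector fields on \<open>U\<close>, extended by zero to \<open>hyp m\<close>.\<close>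

definition C1c_field :: "nat \<Rightarrow> (nat \<Rightarrow> real) set \<Rightarrow> ((nat \<Rightarrow> real) \<Rightarrow> nat \<Rightarrow> real) \<Rightarrow> bool" where
  "C1c_field m U X \<longleftrightarrow>
     (\<forall>x\<in>hyp m. X x \<in> tangent m x) \<and>
     (\<forall>j\<le>m. C1_fun m (\<lambda>x. X x j)) \<and>
     (\<exists>K. compact K \<and> K \<subseteq> U \<and> (\<forall>x\<in>hyp m - K. X x = (\<lambda>_. 0)))"

text \<open>
  The Levi-Civita connection of \<open>hyp m\<close>: the derivative of \<open>X\<close> in Minkowski space along a curve in the
  hyperboloid with velocity \<open>v\<close> at \<open>x\<close>, projected to the tangent space at \<open>x\<close> (as \<open>lor m x x = -1\<close>,
  the projection is \<open>w \<mapsto> w + lor m w x \<cdot> x\<close>).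
\<close>

definition cov_deriv ::
  "nat \<Rightarrow> ((nat \<Rightarrow> real) \<Rightarrow> nat \<Rightarrow> real) \<Rightarrow> (nat \<Rightarrow> real) \<Rightarrow> (nat \<Rightarrow> real) \<Rightarrow> nat \<Rightarrow> real" where
  "cov_deriv m X x v =
     (let w = (\<lambda>j. deriv (\<lambda>t. X (lift m (\<lambda>i. x i + t * v i)) j) 0)
      in (\<lambda>j. w j + lor m w x * x j))"

definition divergence ::
  "nat \<Rightarrow> nat \<Rightarrow> ((nat \<Rightarrow> real) \<Rightarrow> nat \<Rightarrow> real) \<Rightarrow> (nat \<Rightarrow> real) \<Rightarrow> (nat \<Rightarrow> real) set \<Rightarrow> real" where
  "divergence n m X x S =
     (let e = (SOME e. orthonormal_frame n m x e \<and> S = frame_span n e)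
      in \<Sum>i<n. lor m (cov_deriv m X x (e i)) (e i))"

definition stationary :: "nat \<Rightarrow> nat \<Rightarrow> (nat \<Rightarrow> real) set \<Rightarrow> varifold \<Rightarrow> bool" where
  "stationary n m U V \<longleftrightarrow>
     (\<forall>X. C1c_field m U X \<longrightarrow> (\<integral>(x, S). divergence n m X x S \<partial>V) = 0)"

definition fixed_scale_comparison :: "nat \<Rightarrow> real \<Rightarrow> real \<Rightarrow> bool" where
  "fixed_scale_comparison n \<epsilon> C \<longleftrightarrow>
     (\<forall>k m L p V. 1 \<le> k \<longrightarrow> m = n + k \<longrightarrow> totally_geodesic n m L \<longrightarrow> p \<in> L \<longrightarrow>
        integral_varifold n m (hball m p (3/2)) V \<longrightarrow>
        stationary n m (hball m p (3/2)) V \<longrightarrow>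
        varifold_supp m V \<inter> hball m p (3/2) \<subseteq> {x \<in> hyp m. hsetdist m x L < \<epsilon>} \<longrightarrow>
        emeasure (weight V) (hball m p (5/4)) \<le> ennreal C * emeasure (weight V) (hball m p (1/4)))"

end

theory Submission
  imports Defs
begin

text \<open>
  Take \<open>\<epsilon> = min \<epsilon>D (1/4)\<close> and a point \<open>p \<in> L\<close> with \<open>hdist m q p < 1/4\<close>. The triangle inequality gives
  \<open>B\<^bsub>3/2\<^esub>(p) \<subseteq> B\<^sub>2(q)\<close>, \<open>B\<^sub>1(q) \<subseteq> B\<^bsub>5/4\<^esub>(p)\<close> and \<open>B\<^bsub>1/4\<^esub>(p) \<subseteq> B\<^bsub>1/2\<^esub>(q)\<close>, so the claim is the fixed-scale
  comparison for the restriction of \<open>V\<close> to \<open>B\<^bsub>3/2\<^esub>(p)\<close>. That this restriction is again a stationary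
  integral varifold rests on the locality of approximate tangent cones and of the divergence, and on
  the measurability of balls for the Hausdorff measure.
\<close>

section \<open>Hyperbolic distance\<close>

lemma lor_commute: "lor m x y = lor m y x"
  by (simp add: lor_def mult.commute)

lemma lor_add_left: "lor m (\<lambda>i. x i + y i) z = lor m x z + lor m y z"
  by (simp add: lor_def algebra_simps sum.distrib)

lemma lor_scale_left: "lor m (\<lambda>i. c * x i) z = c * lor m x z"
  by (simp add: lor_def algebra_simps sum_distrib_left)

lemma lor_add_right: "lor m z (\<lambda>i. x i + y i) = lor m z x + lor m z y"
  by (metis lor_add_left lor_commute)

lemma lor_scale_right: "lor m z (\<lambda>i. c * x i) = c * lor m z x"
  by (metis lor_scale_left lor_commute)

lemmas lor_linear = lor_add_left lor_add_right lor_scale_left lor_scale_right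

lemma lor_zero [simp]: "lor m (\<lambda>_. 0) y = 0"
  by (simp add: lor_def)

lemma lor_self: "lor m x x = (\<Sum>i=1..m. (x i)\<^sup>2) - (x 0)\<^sup>2"
  by (simp add: lor_def power2_eq_square)

lemma hyp_time: "x \<in> hyp m \<Longrightarrow> 1 + (\<Sum>i=1..m. (x i)\<^sup>2) = (x 0)\<^sup>2"
  using lor_self[of m x] by (simp add: hyp_def)

text \<open>Orthogonality turns \<open>y 0 * u 0\<close> into the Euclidean product of the spatial
  parts. By Cauchy-Schwarz and since the spatial part of \<open>y\<close> is shorter than
  \<open>y 0\<close>, the time coordinate of \<open>u\<close> is dominated by its spatial
  part.\<close>

lemma lor_nonneg_orthogonal:
  assumes y: "y \<in> hyp m" and "lor m y u = 0"
  shows "0 \<le> lor m u u"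
proof -
  let ?Y = "\<Sum>i=1..m. (y i)\<^sup>2" and ?U = "\<Sum>i=1..m. (u i)\<^sup>2"
  have y0: "(y 0)\<^sup>2 = 1 + ?Y" and pos: "0 \<le> ?Y" "0 \<le> ?U"
    using hyp_time[OF y] by (auto intro: sum_nonneg)
  have "y 0 * u 0 = (\<Sum>i=1..m. y i * u i)"
    using assms(2) by (simp add: lor_def)
  then have "(y 0)\<^sup>2 * (u 0)\<^sup>2 \<le> ?Y * ?U"
    using Cauchy_Schwarz_ineq_sum[of y u "{1..m}"] by (metis power_mult_distrib)
  also have "\<dots> \<le> (y 0)\<^sup>2 * ?U"
    using pos by (simp add: y0 algebra_simps)
  finally have "(u 0)\<^sup>2 \<le> ?U"
    using y0 pos by (subst (asm) mult_le_cancel_left_pos) auto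
  then show ?thesis by (simp add: lor_self)
qed

text \<open>The discriminant argument for the form restricted to the span of \<open>u\<close> and
  \<open>w\<close>. The form is only known to be semidefinite there, so the case where both squares
  vanish is separate.\<close>

lemma lor_Cauchy_Schwarz_orthogonal:
  assumes y: "y \<in> hyp m" and u: "lor m y u = 0" and w: "lor m y w = 0"
  shows "(lor m u w)\<^sup>2 \<le> lor m u u * lor m w w"
proof -
  define a b c where abc: "a = lor m u u" "b = lor m u w" "c = lor m w w"
  have "0 \<le> s\<^sup>2 * a + 2 * (s * t * b) + t\<^sup>2 * c" for s t
  proof -
    have "0 \<le> lor m (\<lambda>i. s * u i + t * w i) (\<lambda>i. s * u i + t * w i)"
      by (rule lor_nonneg_orthogonal[OF y]) (simp add: lor_linear u w)
    also have "\<dots> = s\<^sup>2 * a + 2 * (s * t * b) + t\<^sup>2 * c"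
      by (simp add: lor_linear abc lor_commute[of m w u] power2_eq_square algebra_simps)
    finally show ?thesis .
  qed
  note q = this
  have a: "0 \<le> a" and c: "0 \<le> c"
    using q[of 1 0] q[of 0 1] by simp_all
  show ?thesis
  proof (cases "a = 0 \<and> c = 0")
    case True
    then have "b = 0" using q[of 1 1] q[of 1 "-1"] by simp
    then show ?thesis using True abc by simp
  next
    case False
    \<comment> \<open>At \<open>(c, -b)\<close> and \<open>(b, -a)\<close> the quadratic form
      factors through the discriminant \<open>a * c - b\<^sup>2\<close>. At least one of the factors
      \<open>a\<close>, \<open>c\<close> is positive and can be cancelled.\<close>
    have "0 \<le> c * (a * c - b\<^sup>2)" "0 \<le> a * (a * c - b\<^sup>2)"
      using q[of c "-b"] q[of b "-a"] by (simp_all add: power2_eq_square algebra_simps)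
    then have "0 \<le> a * c - b\<^sup>2"
      using False a c by (metis less_eq_real_def zero_le_mult_iff not_less)
    then show ?thesis using abc by simp
  qed
qed

text \<open>The reversed Cauchy-Schwarz inequality for future-directed timelike unit vectors: expand
  the squares of \<open>1 + ?s\<close> and \<open>x 0 * y 0\<close> and compare term by term. It
  places \<open>- lor m x y\<close> in the range where \<open>arcosh\<close> inverts
  \<open>cosh\<close>.\<close>

lemma lor_le_minus_one:
  assumes x: "x \<in> hyp m" and y: "y \<in> hyp m"
  shows "lor m x y \<le> -1"
proof -
  let ?X = "\<Sum>i=1..m. (x i)\<^sup>2" and ?Y = "\<Sum>i=1..m. (y i)\<^sup>2" and ?s = "\<Sum>i=1..m. x i * y i"
  have x0: "(x 0)\<^sup>2 = 1 + ?X" "0 < x 0" and y0: "(y 0)\<^sup>2 = 1 + ?Y" "0 < y 0"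
    using hyp_time[OF x] hyp_time[OF y] x y by (simp_all add: hyp_def)
  have "?s\<^sup>2 \<le> ?X * ?Y" by (rule Cauchy_Schwarz_ineq_sum)
  moreover have "2 * ?s \<le> ?X + ?Y"
  proof -
    have "0 \<le> (\<Sum>i=1..m. (x i - y i)\<^sup>2)" by (intro sum_nonneg) simp
    then show ?thesis
      by (simp add: power2_diff sum.distrib sum_subtractf sum_distrib_left mult.assoc)
  qed
  ultimately have "(1 + ?s)\<^sup>2 \<le> (x 0 * y 0)\<^sup>2"
    by (simp add: power_mult_distrib x0 y0 power2_sum algebra_simps)
  then have "1 + ?s \<le> x 0 * y 0"
    using x0 y0 by (smt (verit) power2_le_imp_le mult_pos_pos)
  then show ?thesis by (simp add: lor_def)
qed

lemma cosh_hdist: "x \<in> hyp m \<Longrightarrow> y \<in> hyp m \<Longrightarrow> cosh (hdist m x y) = - lor m x y"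
  using lor_le_minus_one[of x m y] by (simp add: hdist_def)

lemma hdist_nonneg: "x \<in> hyp m \<Longrightarrow> y \<in> hyp m \<Longrightarrow> 0 \<le> hdist m x y"
  using lor_le_minus_one[of x m y] by (simp add: hdist_def)

lemma hdist_commute: "hdist m x y = hdist m y x"
  by (simp add: hdist_def lor_commute)

text \<open>Split \<open>x\<close> and \<open>z\<close> into their components along \<open>y\<close> and orthogonal to \<open>y\<close>, where \<open>lor m\<close> is
  positive semidefinite: with the Cauchy-Schwarz inequality the claim becomes the addition
  formula for \<open>cosh\<close>.\<close>

lemma hdist_triangle:
  assumes x: "x \<in> hyp m" and y: "y \<in> hyp m" and z: "z \<in> hyp m"
  shows "hdist m x z \<le> hdist m x y + hdist m y z"
proof -
  define a b where a: "a = hdist m x y" and b: "b = hdist m y z"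
  define u where "u = (\<lambda>i. x i + (- cosh a) * y i)"
  define w where "w = (\<lambda>i. z i + (- cosh b) * y i)"
  have ca: "lor m x y = - cosh a" "lor m y x = - cosh a"
    and cb: "lor m y z = - cosh b" "lor m z y = - cosh b"
    using cosh_hdist[OF x y] cosh_hdist[OF y z] lor_commute[of m] by (simp_all add: a b)
  have ab: "0 \<le> a" "0 \<le> b" using x y z by (simp_all add: a b hdist_nonneg)
  have self: "lor m x x = -1" "lor m y y = -1" "lor m z z = -1"
    using x y z by (simp_all add: hyp_def)
  have "lor m y u = 0" "lor m y w = 0"
    unfolding u_def w_def lor_add_right lor_scale_right ca cb self by simp_all
  then have "(lor m u w)\<^sup>2 \<le> lor m u u * lor m w w"
    by (rule lor_Cauchy_Schwarz_orthogonal[OF y])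
  also have "lor m u u = (sinh a)\<^sup>2"
    unfolding u_def lor_linear ca self sinh_square_eq by (simp add: power2_eq_square)
  also have "lor m w w = (sinh b)\<^sup>2"
    unfolding w_def lor_linear cb self sinh_square_eq by (simp add: power2_eq_square)
  finally have "(lor m u w)\<^sup>2 \<le> (sinh a * sinh b)\<^sup>2"
    by (simp add: power_mult_distrib)
  then have "\<bar>lor m u w\<bar> \<le> sinh a * sinh b"
    using ab by (metis abs_le_square_iff abs_of_nonneg mult_nonneg_nonneg sinh_real_nonneg_iff)
  moreover have "lor m u w = lor m x z + cosh a * cosh b"
    unfolding u_def w_def lor_linear ca cb self by simp
  ultimately have "- lor m x z \<le> cosh (a + b)"
    by (simp add: cosh_add)
  then have "cosh (hdist m x z) \<le> cosh (a + b)"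
    using cosh_hdist[OF x z] by simp
  then show ?thesis
    using cosh_real_nonneg_le_iff[of "hdist m x z" "a + b"] hdist_nonneg[OF x z] ab
    by (simp add: a b)
qed

section \<open>Hyperbolic balls: inclusions and Borel measurability\<close>

lemma hball_subset:
  assumes "x \<in> hyp m" "y \<in> hyp m" "hdist m x y + r \<le> s"
  shows "hball m y r \<subseteq> hball m x s"
  using assms hdist_triangle[OF assms(1,2)] by (fastforce simp: hball_def)

lemma hball_local:
  assumes p: "p \<in> hyp m" and "x \<in> hball m p s"
  obtains r where "0 < r" "hball m x r \<subseteq> hball m p s"
proof
  show "0 < s - hdist m p x" "hball m x (s - hdist m p x) \<subseteq> hball m p s"
    using assms hball_subset[of p m x "s - hdist m p x" s] by (auto simp: hball_def)
qed

lemma continuous_on_lor: "continuous_on UNIV (lor m p)"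
  unfolding lor_def by (intro continuous_intros) auto

text \<open>\<open>cosh\<close> is strictly increasing on the nonnegative reals, so a distance bound
  is the same as a lower bound on \<open>lor m p\<close>, which is continuous for the product
  topology.\<close>

lemma hball_eq_Int_open:
  assumes p: "p \<in> hyp m" and "0 < s"
  obtains W where "open W" "hball m p s = W \<inter> hyp m"
proof
  show "open (lor m p -` {- cosh s<..})"
    by (intro open_vimage continuous_on_lor) auto
  have "hdist m p x < s \<longleftrightarrow> - cosh s < lor m p x" if "x \<in> hyp m" for x
    using cosh_real_nonneg_less_iff[of "hdist m p x" s] hdist_nonneg[OF p that] cosh_hdist[OF p that]
      \<open>0 < s\<close> by auto
  then show "hball m p s = lor m p -` {- cosh s<..} \<inter> hyp m"
    by (auto simp: hball_def)
qed

text \<open>The weight of a varifold is a measure on the Borel sets of all of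
  \<open>nat \<Rightarrow> real\<close>, so balls have to be Borel in the ambient space and not only
  relative to the hyperboloid.\<close>

lemma hyp_borel: "hyp m \<in> sets borel"
proof -
  have eq: "hyp m = (\<Inter>i\<in>{Suc m..}. {x. x i = 0}) \<inter> {x. lor m x x = -1} \<inter> {x. 0 < x 0}"
    by (auto simp: hyp_def topspace_Euclidean_space)
  have "continuous_on UNIV (\<lambda>x. lor m x x)"
    unfolding lor_def by (intro continuous_intros) auto
  then have "closed {x. lor m x x = -1}"
    by (intro closed_Collect_eq) auto
  moreover have "closed (\<Inter>i\<in>{Suc m..}. {x :: nat \<Rightarrow> real. x i = 0})"
    by (intro closed_INT ballI closed_Collect_eq) auto
  moreover have "open {x :: nat \<Rightarrow> real. 0 < x 0}"
    by (intro open_Collect_less) auto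
  ultimately show ?thesis
    unfolding eq by (intro sets.Int borel_closed borel_open)
qed

lemma hball_borel: "p \<in> hyp m \<Longrightarrow> 0 < s \<Longrightarrow> hball m p s \<in> sets borel"
  by (metis hball_eq_Int_open hyp_borel borel_open sets.Int)

section \<open>Measurability of balls for the Hausdorff measure\<close>

text \<open>Caratheodory's criterion.  The shells between the levels \<open>s - 1/(k+1)\<close> and \<open>s - 1/(k+2)\<close>
  are separated once every second one is left out, so the sum of their measures is finite and
  \<open>{f < s}\<close> is exhausted in measure by sets separated from \<open>{f \<ge> s}\<close>.\<close>

lemma sublevel_in_lambda_system:
  fixes \<mu> :: "'a set \<Rightarrow> ennreal" and f :: "'a \<Rightarrow> real"
  assumes empty: "\<mu> {} = 0"
    and mono: "\<And>A B. A \<subseteq> B \<Longrightarrow> B \<subseteq> \<Omega> \<Longrightarrow> \<mu> A \<le> \<mu> B"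
    and subadd: "\<And>A :: nat \<Rightarrow> 'a set. (\<Union>i. A i) \<subseteq> \<Omega> \<Longrightarrow> \<mu> (\<Union>i. A i) \<le> (\<Sum>i. \<mu> (A i))"
    and separated: "\<And>A B a b. A \<union> B \<subseteq> \<Omega> \<Longrightarrow> a < b \<Longrightarrow> (\<And>x. x \<in> A \<Longrightarrow> f x \<le> a) \<Longrightarrow>
      (\<And>x. x \<in> B \<Longrightarrow> b \<le> f x) \<Longrightarrow> \<mu> A + \<mu> B \<le> \<mu> (A \<union> B)"
  shows "{x \<in> \<Omega>. f x < s} \<in> lambda_system \<Omega> (Pow \<Omega>) \<mu>"
proof -
  \<comment> \<open>Finite subadditivity comes from the countable one by padding the pair with empty
    sets, which have measure zero.\<close>
  have subadd2: "\<mu> (A \<union> B) \<le> \<mu> A + \<mu> B" if "A \<union> B \<subseteq> \<Omega>" for A B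
  proof -
    have "\<mu> (\<Union>i. binaryset A B i) \<le> (\<Sum>i. \<mu> (binaryset A B i))"
      using that by (intro subadd) (simp add: UN_binaryset_eq)
    then show ?thesis
      by (simp add: UN_binaryset_eq suminf_binaryset_eq empty)
  qed
  have "\<mu> ({x \<in> \<Omega>. f x < s} \<inter> T) + \<mu> ((\<Omega> - {x \<in> \<Omega>. f x < s}) \<inter> T) = \<mu> T" if T: "T \<subseteq> \<Omega>" for T
  proof -
    define S where "S = {x \<in> T. f x < s}"
    define B where "B = {x \<in> T. s \<le> f x}"
    have SB: "{x \<in> \<Omega>. f x < s} \<inter> T = S" "(\<Omega> - {x \<in> \<Omega>. f x < s}) \<inter> T = B" "S \<union> B = T"
      using T by (auto simp: S_def B_def)
    define l where "l k = s - 1 / real (Suc k)" for k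
    have l_less: "l j < l k" if "j < k" for j k
      using that by (simp add: l_def frac_less2)
    have l_s: "l k < s" for k by (simp add: l_def)
    have l_ex: "\<exists>k. t \<le> l k" if ts: "t < s" for t
    proof -
      obtain k where "inverse (real (Suc k)) < s - t"
        using reals_Archimedean[of "s - t"] ts by auto
      then have "t \<le> l k" by (simp add: l_def inverse_eq_divide)
      then show ?thesis ..
    qed
    define A where "A k = {x \<in> T. f x \<le> l k}" for k
    define R where "R k = {x \<in> T. l k < f x \<and> f x \<le> l (Suc k)}" for k
    have RT: "R k \<subseteq> T" for k by (auto simp: R_def)
    have "\<mu> S + \<mu> B \<le> \<mu> T"
    proof (rule ennreal_le_epsilon)
      fix e :: real
      assume fin: "\<mu> T < top" and "0 < e"
      \<comment> \<open>Induction over shells of one parity. The shells already collected lie below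
        level \<open>l (2 * N + c - 1)\<close> and the next one above \<open>l (2 * N + c)\<close>;
        the omitted shell between them provides the gap.\<close>
      have alternate: "(\<Sum>j<N. \<mu> (R (2 * j + c))) \<le> \<mu> T" for N c
      proof -
        have "(\<Sum>j<N. \<mu> (R (2 * j + c))) \<le> \<mu> (\<Union>j<N. R (2 * j + c))"
        proof (induction N)
          case (Suc N)
          have "(\<Sum>j<Suc N. \<mu> (R (2 * j + c))) \<le> \<mu> (\<Union>j<N. R (2 * j + c)) + \<mu> (R (2 * N + c))"
            using Suc by (simp add: add_right_mono)
          also have "\<dots> \<le> \<mu> ((\<Union>j<N. R (2 * j + c)) \<union> R (2 * N + c))"
          proof (cases "N = 0")
            \<comment> \<open>Only for positive \<open>N\<close> is the index
              \<open>2 * N + c - 1\<close> a true predecessor; for \<open>N = 0\<close> the union is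
              empty.\<close>
            case False
            show ?thesis
            proof (rule separated)
              show "l (2 * N + c - 1) < l (2 * N + c)" using False by (intro l_less) auto
              show "f x \<le> l (2 * N + c - 1)" if x: "x \<in> (\<Union>j<N. R (2 * j + c))" for x
              proof -
                obtain j where "j < N" "f x \<le> l (Suc (2 * j + c))" using x by (auto simp: R_def)
                moreover have "l (Suc (2 * j + c)) \<le> l (2 * N + c - 1)"
                proof (cases "Suc (2 * j + c) = 2 * N + c - 1")
                  case False
                  then show ?thesis using \<open>j < N\<close> by (intro less_imp_le l_less) linarith
                qed simp
                ultimately show ?thesis by linarith
              qed
            qed (use RT T in \<open>auto simp: R_def\<close>)
          qed (simp add: empty)
          also have "(\<Union>j<N. R (2 * j + c)) \<union> R (2 * N + c) = (\<Union>j<Suc N. R (2 * j + c))"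
            by (auto simp: lessThan_Suc)
          finally show ?case .
        qed simp
        also have "\<dots> \<le> \<mu> T" using RT T by (intro mono) auto
        finally show ?thesis .
      qed
      have double: "(\<Sum>k<2 * N. \<mu> (R k)) = (\<Sum>j<N. \<mu> (R (2 * j + 0))) + (\<Sum>j<N. \<mu> (R (2 * j + 1)))" for N
        by (induction N) (simp_all add: algebra_simps)
      have "(\<Sum>k. \<mu> (R k)) \<le> \<mu> T + \<mu> T"
      proof (rule suminf_le_const)
        fix N
        have "(\<Sum>k<N. \<mu> (R k)) \<le> (\<Sum>k<2 * N. \<mu> (R k))" by (intro sum_mono2) auto
        also have "\<dots> \<le> \<mu> T + \<mu> T" unfolding double by (intro add_mono alternate)
        finally show "(\<Sum>k<N. \<mu> (R k)) \<le> \<mu> T + \<mu> T" .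
      qed simp
      also have "\<dots> < top" using fin by simp
      finally have sum_fin: "(\<Sum>k. \<mu> (R k)) < top" .
      \<comment> \<open>The series of shell measures is finite, so some partial sum comes within
        \<open>e\<close> of it; otherwise the supremum of the partial sums plus \<open>e\<close>
        would not exceed the sum.\<close>
      have "\<exists>k. (\<Sum>i. \<mu> (R i)) < (\<Sum>i<k. \<mu> (R i)) + ennreal e"
      proof (rule ccontr)
        assume "\<not> ?thesis"
        then have "(\<Sum>i<k. \<mu> (R i)) + ennreal e \<le> (\<Sum>i. \<mu> (R i))" for k
          by (meson not_less)
        then have "(SUP k. (\<Sum>i<k. \<mu> (R i)) + ennreal e) \<le> (\<Sum>i. \<mu> (R i))"
          by (rule SUP_least)
        then have "(\<Sum>i. \<mu> (R i)) + ennreal e \<le> (\<Sum>i. \<mu> (R i))"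
          by (simp add: ennreal_SUP_add_left suminf_eq_SUP)
        then show False
          using sum_fin \<open>0 < e\<close> by (simp add: ennreal_add_left_cancel_le add.commute[of _ "ennreal e"]) 
      qed
      then obtain k where k: "(\<Sum>i. \<mu> (R i)) \<le> (\<Sum>i<k. \<mu> (R i)) + ennreal e"
        by (meson less_imp_le)
      have "(\<Sum>i<k. \<mu> (R i)) + (\<Sum>i. \<mu> (R (i + k))) = (\<Sum>i. \<mu> (R i))"
        by (simp add: suminf_offset[of "\<lambda>i. \<mu> (R i)" k] add.commute)
      moreover have "(\<Sum>i<k. \<mu> (R i)) \<noteq> top"
        by (intro less_imp_neq le_less_trans[OF _ sum_fin] sum_le_suminf) auto
      ultimately have tail: "(\<Sum>i. \<mu> (R (i + k))) \<le> ennreal e"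
        using k by (metis ennreal_add_left_cancel_le infinity_ennreal_def)
      have SA: "S \<subseteq> A k \<union> (\<Union>i. R (i + k))"
      proof
        fix x assume "x \<in> S"
        then have x: "x \<in> T" "f x < s" by (auto simp: S_def)
        \<comment> \<open>The first level reaching \<open>f x\<close>. If it comes after
          \<open>k\<close>, minimality puts \<open>x\<close> strictly above the preceding level,
          hence in the shell numbered \<open>j - 1\<close>.\<close>
        define j where "j = (LEAST j. f x \<le> l j)"
        have j: "f x \<le> l j" unfolding j_def by (rule LeastI_ex) (rule l_ex[OF x(2)])
        show "x \<in> A k \<union> (\<Union>i. R (i + k))"
        proof (cases "f x \<le> l k")
          case True
          then show ?thesis using x by (simp add: A_def)
        next
          case False
          then have "k < j" using j l_less[of j k] by (metis linorder_neqE_nat less_imp_le order_trans)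
          then obtain i where i: "j = Suc (i + k)" by (metis less_natE add.commute)
          have "\<not> f x \<le> l (i + k)" using not_less_Least[of "i + k" "\<lambda>j. f x \<le> l j"] i j_def by simp
          then have "x \<in> R (i + k)" using x j i by (simp add: R_def)
          then show ?thesis by blast
        qed
      qed
      have AR: "A k \<union> (\<Union>i. R (i + k)) \<subseteq> \<Omega>"
        using T by (auto simp: A_def R_def)
      have "\<mu> S \<le> \<mu> (A k \<union> (\<Union>i. R (i + k)))"
        by (rule mono[OF SA AR])
      also have "\<dots> \<le> \<mu> (A k) + \<mu> (\<Union>i. R (i + k))"
        by (rule subadd2[OF AR])
      also have "\<dots> \<le> \<mu> (A k) + (\<Sum>i. \<mu> (R (i + k)))"
        using AR by (intro add_left_mono subadd) simp
      also have "\<dots> \<le> \<mu> (A k) + ennreal e"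
        by (intro add_left_mono tail)
      finally have "\<mu> S + \<mu> B \<le> (\<mu> (A k) + \<mu> B) + ennreal e"
        by (metis add_right_mono add.assoc add.commute)
      \<comment> \<open>Here separation is applied across the gap between \<open>l k\<close> and
        \<open>s\<close>.\<close>
      also have "\<mu> (A k) + \<mu> B \<le> \<mu> (A k \<union> B)"
        using T by (intro separated[OF _ l_s[of k]]) (auto simp: A_def B_def)
      also have "\<mu> (A k \<union> B) \<le> \<mu> T"
        using T by (intro mono) (auto simp: A_def B_def)
      finally show "\<mu> S + \<mu> B \<le> \<mu> T + ennreal e"
        by (simp add: add_right_mono)
    qed
    moreover have "\<mu> T \<le> \<mu> S + \<mu> B"
      using subadd2[of S B] SB T by simp
    ultimately show ?thesis by (simp add: SB)
  qed
  then show ?thesis by (auto simp: lambda_system_def)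
qed

section \<open>The Hausdorff premeasures and the Hausdorff outer measure\<close>

definition hcover :: "nat \<Rightarrow> real \<Rightarrow> (nat \<Rightarrow> real) set \<Rightarrow> (nat \<Rightarrow> (nat \<Rightarrow> real) set) \<Rightarrow> bool" where
  "hcover m \<delta> A C \<longleftrightarrow> (\<forall>i. C i \<subseteq> hyp m \<and> hdiam m (C i) \<le> ennreal \<delta>) \<and> A \<subseteq> (\<Union>i. C i)"

definition hcost :: "nat \<Rightarrow> nat \<Rightarrow> (nat \<Rightarrow> real) set \<Rightarrow> ennreal" where
  "hcost n m C = ennreal (unit_ball_vol (real n)) * (hdiam m C / 2) ^ n"

lemma hausdorff_pre_eq: "hausdorff_pre n m \<delta> A = (INF C\<in>{C. hcover m \<delta> A C}. \<Sum>i. hcost n m (C i))"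
  by (simp add: hausdorff_pre_def hcover_def hcost_def)

lemma hausdorff_pre_le: "hcover m \<delta> A C \<Longrightarrow> hausdorff_pre n m \<delta> A \<le> (\<Sum>i. hcost n m (C i))"
  unfolding hausdorff_pre_eq by (rule INF_lower) simp

lemma hausdorff_pre_close:
  "hausdorff_pre n m \<delta> A < c \<Longrightarrow> \<exists>C. hcover m \<delta> A C \<and> (\<Sum>i. hcost n m (C i)) \<le> c"
  unfolding hausdorff_pre_eq INF_less_iff by (auto intro: less_imp_le)

lemma hdiam_empty [simp]: "hdiam m {} = 0"
  by (simp add: hdiam_def bot_ennreal)

text \<open>Positive dimension matters because \<open>0 ^ 0 = 1\<close>: in dimension zero each
  empty member of a cover would cost one. Free empty members allow covers to be thinned out.\<close>

lemma hcost_empty: "1 \<le> n \<Longrightarrow> hcost n m {} = 0"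
  by (simp add: hcost_def zero_power)

lemma hausdorff_pre_empty:
  assumes "1 \<le> n"
  shows "hausdorff_pre n m \<delta> {} = 0"
  using hausdorff_pre_le[of m \<delta> "{}" "\<lambda>_. {}" n] assms by (simp add: hcover_def hcost_empty)

lemma hausdorff_pre_mono:
  assumes "A \<subseteq> B" "\<delta> \<le> \<delta>'"
  shows "hausdorff_pre n m \<delta>' A \<le> hausdorff_pre n m \<delta> B"
proof -
  have "{C. hcover m \<delta> B C} \<subseteq> {C. hcover m \<delta>' A C}"
    using assms unfolding hcover_def by (blast intro: order_trans ennreal_leI)
  then show ?thesis
    unfolding hausdorff_pre_eq by (intro INF_superset_mono) auto
qed

text \<open>Choose for each \<open>A i\<close> a cover that is optimal up to
  \<open>e / 2 ^ (i + 1)\<close> and enumerate the double sequence by \<open>prod_decode\<close>;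
  the errors add up to \<open>e\<close>. Finiteness of the right-hand side makes such near-optimal
  covers available.\<close>

lemma hausdorff_pre_subadditive:
  "hausdorff_pre n m \<delta> (\<Union>i. A i) \<le> (\<Sum>i. hausdorff_pre n m \<delta> (A i))"
proof (rule ennreal_le_epsilon)
  fix e :: real
  assume "0 < e" "(\<Sum>i. hausdorff_pre n m \<delta> (A i)) < top"
  then have "hausdorff_pre n m \<delta> (A i) < hausdorff_pre n m \<delta> (A i) + e * (1/2) ^ Suc i" for i
    by (auto simp: less_top dest!: ennreal_suminf_lessD)
  note hausdorff_pre_close[OF this]
  then obtain B where B: "\<And>i. hcover m \<delta> (A i) (B i)"
    and le: "\<And>i. (\<Sum>j. hcost n m (B i j)) \<le> hausdorff_pre n m \<delta> (A i) + e * (1/2) ^ Suc i"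
    by metis
  define C where "C = case_prod B \<circ> prod_decode"
  have "B i j = C (prod_encode (i, j))" for i j by (simp add: C_def)
  moreover have "A i \<subseteq> (\<Union>j. B i j)" for i
    using B by (simp add: hcover_def)
  ultimately have "(\<Union>i. A i) \<subseteq> (\<Union>k. C k)"
    by fastforce
  then have "hcover m \<delta> (\<Union>i. A i) C"
    using B by (auto simp: hcover_def C_def split_def)
  then have "hausdorff_pre n m \<delta> (\<Union>i. A i) \<le> (\<Sum>k. hcost n m (C k))"
    by (rule hausdorff_pre_le)
  also have "\<dots> = (\<Sum>i. \<Sum>j. hcost n m (B i j))"
    unfolding C_def comp_def
    by (rule suminf_ennreal_2dimen[where f = "\<lambda>p. hcost n m (case_prod B p)"]) simp
  also have "\<dots> \<le> (\<Sum>i. hausdorff_pre n m \<delta> (A i) + e * (1/2) ^ Suc i)"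
    by (intro suminf_le le) auto
  also have "\<dots> = (\<Sum>i. hausdorff_pre n m \<delta> (A i)) + (\<Sum>i. ennreal e * ennreal ((1/2) ^ Suc i))"
    using \<open>0 < e\<close> by (subst suminf_add[symmetric])
      (auto simp del: ennreal_suminf_cmult simp add: ennreal_mult[symmetric])
  also have "\<dots> = (\<Sum>i. hausdorff_pre n m \<delta> (A i)) + e"
    unfolding ennreal_suminf_cmult
    by (subst suminf_ennreal_eq[OF zero_le_power power_half_series]) auto
  finally show "hausdorff_pre n m \<delta> (\<Union>i. A i) \<le> (\<Sum>i. hausdorff_pre n m \<delta> (A i)) + e" .
qed

lemma hdist_le_hdiam: "x \<in> C \<Longrightarrow> y \<in> C \<Longrightarrow> ennreal (hdist m x y) \<le> hdiam m C"
  unfolding hdiam_def by (rule SUP_upper2, assumption, rule SUP_upper)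

text \<open>A set of diameter below the distance of \<open>A\<close> and \<open>B\<close> cannot meet both, so a cover of \<open>A \<union> B\<close>
  splits into covers of \<open>A\<close> and of \<open>B\<close>.\<close>

lemma hausdorff_pre_separated:
  assumes n: "1 \<le> n" and \<delta>: "0 < \<delta>" "\<delta> < d"
    and d: "\<And>x y. x \<in> A \<Longrightarrow> y \<in> B \<Longrightarrow> d \<le> hdist m x y"
  shows "hausdorff_pre n m \<delta> A + hausdorff_pre n m \<delta> B \<le> hausdorff_pre n m \<delta> (A \<union> B)"
  unfolding hausdorff_pre_eq[of n m \<delta> "A \<union> B"]
proof (rule INF_greatest)
  fix C assume "C \<in> {C. hcover m \<delta> (A \<union> B) C}"
  then have C: "hcover m \<delta> (A \<union> B) C" by simp
  define CA where "CA i = (if C i \<inter> A = {} then {} else C i)" for i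
  define CB where "CB i = (if C i \<inter> B = {} then {} else C i)" for i
  have "hcover m \<delta> A CA" "hcover m \<delta> B CB"
    using C by (fastforce simp: hcover_def CA_def CB_def)+
  then have "hausdorff_pre n m \<delta> A + hausdorff_pre n m \<delta> B
      \<le> (\<Sum>i. hcost n m (CA i)) + (\<Sum>i. hcost n m (CB i))"
    by (intro add_mono hausdorff_pre_le)
  also have "\<dots> = (\<Sum>i. hcost n m (CA i) + hcost n m (CB i))"
    by (intro suminf_add) auto
  also have "\<dots> \<le> (\<Sum>i. hcost n m (C i))"
  proof (intro suminf_le)
    fix i
    have "C i \<inter> A = {} \<or> C i \<inter> B = {}"
    proof (rule ccontr)
      assume "\<not> ?thesis"
      then obtain x y where xy: "x \<in> C i" "x \<in> A" "y \<in> C i" "y \<in> B" by blast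
      then have "ennreal (hdist m x y) \<le> ennreal \<delta>"
        using C hdist_le_hdiam[of x "C i" y m] by (auto simp: hcover_def intro: order_trans)
      then show False
        using d[OF xy(2,4)] \<delta> by simp
    qed
    then show "hcost n m (CA i) + hcost n m (CB i) \<le> hcost n m (C i)"
      by (auto simp: CA_def CB_def hcost_empty[OF n])
  qed auto
  finally show "hausdorff_pre n m \<delta> A + hausdorff_pre n m \<delta> B \<le> (\<Sum>i. hcost n m (C i))" .
qed

lemma hausdorff_pre_le_outer: "0 < \<delta> \<Longrightarrow> hausdorff_pre n m \<delta> A \<le> hausdorff_outer n m A"
  unfolding hausdorff_outer_def by (rule SUP_upper) simp

text \<open>Premeasures grow as the scale shrinks, so the two suprema can be taken along a common
  scale, and that scale can be made smaller than the gap \<open>d\<close>.\<close>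

lemma hausdorff_outer_separated:
  assumes n: "1 \<le> n" and "0 < d"
    and d: "\<And>x y. x \<in> A \<Longrightarrow> y \<in> B \<Longrightarrow> d \<le> hdist m x y"
  shows "hausdorff_outer n m A + hausdorff_outer n m B \<le> hausdorff_outer n m (A \<union> B)"
proof -
  have "hausdorff_outer n m A + hausdorff_outer n m B =
      (SUP \<delta>\<in>{0<..}. hausdorff_pre n m \<delta> A + hausdorff_pre n m \<delta> B)"
    unfolding hausdorff_outer_def
  proof (rule SUP_add_directed_ennreal[symmetric])
    fix i j :: real assume "i \<in> {0<..}" "j \<in> {0<..}"
    then show "\<exists>k\<in>{0<..}. hausdorff_pre n m i A + hausdorff_pre n m j B
        \<le> hausdorff_pre n m k A + hausdorff_pre n m k B"
      by (intro bexI[of _ "min i j"] add_mono hausdorff_pre_mono) auto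
  qed
  also have "\<dots> \<le> hausdorff_outer n m (A \<union> B)"
  proof (rule SUP_least)
    fix \<delta> :: real assume \<delta>: "\<delta> \<in> {0<..}"
    \<comment> \<open>Half of \<open>d\<close> makes the scale strictly smaller than the gap, as the
      splitting of covers requires.\<close>
    let ?\<delta> = "min \<delta> (d / 2)"
    have "hausdorff_pre n m \<delta> A + hausdorff_pre n m \<delta> B
        \<le> hausdorff_pre n m ?\<delta> A + hausdorff_pre n m ?\<delta> B"
      by (intro add_mono hausdorff_pre_mono) auto
    also have "\<dots> \<le> hausdorff_pre n m ?\<delta> (A \<union> B)"
      using \<delta> \<open>0 < d\<close> by (intro hausdorff_pre_separated[OF n _ _ d]) auto
    also have "\<dots> \<le> hausdorff_outer n m (A \<union> B)"
      using \<delta> \<open>0 < d\<close> by (intro hausdorff_pre_le_outer) auto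
    finally show "hausdorff_pre n m \<delta> A + hausdorff_pre n m \<delta> B \<le> hausdorff_outer n m (A \<union> B)" .
  qed
  finally show ?thesis .
qed

lemma hausdorff_outer_subadditive:
  "hausdorff_outer n m (\<Union>i. A i) \<le> (\<Sum>i. hausdorff_outer n m (A i))"
  unfolding hausdorff_outer_def[of n m "\<Union>i. A i"]
proof (rule SUP_least)
  fix \<delta> :: real assume "\<delta> \<in> {0<..}"
  then have "(\<Sum>i. hausdorff_pre n m \<delta> (A i)) \<le> (\<Sum>i. hausdorff_outer n m (A i))"
    by (intro suminf_le hausdorff_pre_le_outer) auto
  then show "hausdorff_pre n m \<delta> (\<Union>i. A i) \<le> (\<Sum>i. hausdorff_outer n m (A i))"
    using hausdorff_pre_subadditive order_trans by blast
qed

lemma hausdorff_outer_mono: "A \<subseteq> B \<Longrightarrow> hausdorff_outer n m A \<le> hausdorff_outer n m B"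
  unfolding hausdorff_outer_def by (intro SUP_mono' hausdorff_pre_mono) auto

lemma hausdorff_outer_empty: "1 \<le> n \<Longrightarrow> hausdorff_outer n m {} = 0"
  by (simp add: hausdorff_outer_def hausdorff_pre_empty)

text \<open>The sublevel criterion is applied to the distance from \<open>p\<close>. By the triangle
  inequality, points at levels at most \<open>a\<close> and at least \<open>b\<close> are at
  distance at least \<open>b - a\<close>.\<close>

lemma hball_hausdorff:
  assumes n: "1 \<le> n" and p: "p \<in> hyp m"
  shows "hball m p s \<in> sets (hausdorff n m)"
proof -
  have "{x \<in> hyp m. hdist m p x < s} \<in> lambda_system (hyp m) (Pow (hyp m)) (hausdorff_outer n m)"
  proof (rule sublevel_in_lambda_system)
    fix A B and a b :: real
    assume AB: "A \<union> B \<subseteq> hyp m" "a < b"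
      and A: "\<And>x. x \<in> A \<Longrightarrow> hdist m p x \<le> a" and B: "\<And>x. x \<in> B \<Longrightarrow> b \<le> hdist m p x"
    show "hausdorff_outer n m A + hausdorff_outer n m B \<le> hausdorff_outer n m (A \<union> B)"
    proof (rule hausdorff_outer_separated[OF n])
      show "0 < b - a" using AB by simp
      show "b - a \<le> hdist m x y" if "x \<in> A" "y \<in> B" for x y
        using that AB A[of x] B[of y] hdist_triangle[of p m x y] p by fastforce
    qed
  qed (use n in \<open>auto intro: hausdorff_outer_empty hausdorff_outer_mono hausdorff_outer_subadditive\<close>)
  then show ?thesis
    unfolding hausdorff_def hball_def
    by (subst sets_measure_of) (auto simp: lambda_system_def)
qed

section \<open>Restriction of varifolds to balls\<close>

text \<open>Upper density at \<open>x\<close> involves only arbitrarily small radii, and all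
  sufficiently small balls about \<open>x\<close> lie in the given ball.\<close>

lemma approx_tangent_Int_hball:
  assumes p: "p \<in> hyp m" and x: "x \<in> hball m p s"
  shows "approx_tangent n m (M \<inter> hball m p s) x = approx_tangent n m M x"
proof -
  obtain r0 where r0: "0 < r0" "hball m x r0 \<subseteq> hball m p s"
    using hball_local[OF p x] .
  have "\<forall>\<^sub>F r in at_right 0. hball m x r \<subseteq> hball m p s"
    using r0 unfolding eventually_at_right[OF zero_less_one]
    by (intro exI[of _ r0]) (auto simp: hball_def)
  then have "\<forall>\<^sub>F r in at_right 0. M \<inter> hball m p s \<inter> D \<inter> hball m x r = M \<inter> D \<inter> hball m x r" for D
    by eventually_elim auto
  note ev = this
  have "Limsup (at_right 0) (\<lambda>r. h (M \<inter> hball m p s \<inter> D \<inter> hball m x r) r)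
      = Limsup (at_right 0) (\<lambda>r. h (M \<inter> D \<inter> hball m x r) r)"
    for D and h :: "(nat \<Rightarrow> real) set \<Rightarrow> real \<Rightarrow> ennreal"
    by (rule Limsup_eq, rule eventually_mono[OF ev[of D]]) simp
  from this[where h = "\<lambda>A r. hausdorff_outer n m A / ennreal (unit_ball_vol (real n) * r ^ n)"]
  show ?thesis
    by (simp add: approx_tangent_def)
qed

section \<open>Restriction of the Grassmann bundle, the weight and the support\<close>

lemma space_grassmann_borel [simp]: "space (grassmann_borel n m U) = grassmann n m U"
  by (simp add: grassmann_borel_def)

text \<open>The base point is the first component of the map that generates the
  sigma-algebra.\<close>

lemma measurable_fst_grassmann: "fst \<in> grassmann_borel n m U \<rightarrow>\<^sub>M borel"
proof -
  let ?g = "\<lambda>(x, S). (x, \<lambda>j. lor_proj m S (\<lambda>i. if i = j then 1 else 0))"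
  have g: "?g \<in> grassmann_borel n m U \<rightarrow>\<^sub>M (borel :: ((nat \<Rightarrow> real) \<times> (nat \<Rightarrow> nat \<Rightarrow> real)) measure)"
    unfolding grassmann_borel_def by (rule measurable_vimage_algebra1) simp
  have "fst \<in> (borel :: ((nat \<Rightarrow> real) \<times> (nat \<Rightarrow> nat \<Rightarrow> real)) measure) \<rightarrow>\<^sub>M borel"
    by (intro borel_measurable_continuous_onI continuous_intros)
  from measurable_compose[OF g this] show ?thesis
    by (simp add: split_def)
qed

lemma grassmann_Int: "U' \<subseteq> U \<Longrightarrow> grassmann n m U' = grassmann n m U \<inter> fst -` U'"
  by (auto simp: grassmann_def)

text \<open>Both sigma-algebras are pulled back from the same Borel space along the same map, so
  taking traces only intersects the preimages with the smaller bundle.\<close>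

lemma sets_restrict_grassmann:
  assumes "U' \<subseteq> U"
  shows "sets (restrict_space (grassmann_borel n m U) (grassmann n m U')) = sets (grassmann_borel n m U')"
proof -
  have "grassmann n m U' \<subseteq> grassmann n m U"
    using grassmann_Int[OF assms] by blast
  then show ?thesis
    unfolding sets_restrict_space grassmann_borel_def
    by (subst (1 2) sets_vimage_algebra2) (auto simp: Int_absorb1 Int_left_commute)
qed

lemma space_varifold: "sets V = sets (grassmann_borel n m U) \<Longrightarrow> space V = grassmann n m U"
  by (auto dest: sets_eq_imp_space_eq)

lemma emeasure_weight:
  assumes "sets V = sets (grassmann_borel n m U)" "A \<in> sets borel"
  shows "emeasure (weight V) A = emeasure V (fst -` A \<inter> grassmann n m U)"
proof -
  have "fst \<in> V \<rightarrow>\<^sub>M borel"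
    using measurable_fst_grassmann measurable_cong_sets[OF assms(1) refl] by blast
  then show ?thesis
    using assms(2) by (simp add: weight_def emeasure_distr space_varifold[OF assms(1)])
qed

context
  fixes n m :: nat and U U' :: "(nat \<Rightarrow> real) set" and V :: varifold
  assumes sets_V: "sets V = sets (grassmann_borel n m U)" and U': "U' \<subseteq> U" "U' \<in> sets borel"
begin

lemma grassmann_sets: "grassmann n m U' \<in> sets V"
  using measurable_sets[OF measurable_fst_grassmann U'(2), of n m U]
  by (simp add: grassmann_Int[OF U'(1)] sets_V Int_commute)

lemma sets_restrict_varifold: "sets (restrict_space V (grassmann n m U')) = sets (grassmann_borel n m U')"
  using sets_restrict_grassmann[OF U'(1)] by (simp add: sets_restrict_space sets_V)

lemma emeasure_restrict_varifold:
  "A \<subseteq> grassmann n m U' \<Longrightarrow> emeasure (restrict_space V (grassmann n m U')) A = emeasure V A"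
  using grassmann_sets by (intro emeasure_restrict_space) (auto intro: sets.Int)

end

lemma emeasure_weight_restrict:
  assumes V: "sets V = sets (grassmann_borel n m U)" and U': "U' \<subseteq> U" "U' \<in> sets borel"
    and A: "A \<in> sets borel"
  shows "emeasure (weight (restrict_space V (grassmann n m U'))) A = emeasure (weight V) (A \<inter> U')"
proof -
  have "emeasure (weight (restrict_space V (grassmann n m U'))) A
      = emeasure (restrict_space V (grassmann n m U')) (fst -` A \<inter> grassmann n m U')"
    by (rule emeasure_weight[OF sets_restrict_varifold[OF V U'] A])
  also have "\<dots> = emeasure V (fst -` A \<inter> grassmann n m U')"
    by (rule emeasure_restrict_varifold[OF V U']) simp
  also have "fst -` A \<inter> grassmann n m U' = fst -` (A \<inter> U') \<inter> grassmann n m U"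
    using grassmann_Int[OF U'(1)] by auto
  also have "emeasure V \<dots> = emeasure (weight V) (A \<inter> U')"
    using A U' by (intro emeasure_weight[OF V, symmetric]) auto
  finally show ?thesis .
qed

lemma varifold_supp_restrict:
  assumes V: "sets V = sets (grassmann_borel n m U)" and U': "U' \<subseteq> U" "U' \<in> sets borel"
  shows "varifold_supp m (restrict_space V (grassmann n m U')) \<subseteq> varifold_supp m V"
proof
  fix x assume x: "x \<in> varifold_supp m (restrict_space V (grassmann n m U'))"
  have "0 < emeasure (weight V) (hball m x r)" if r: "r > 0" for r
  proof -
    have B: "hball m x r \<in> sets borel"
      using x r by (intro hball_borel) (auto simp: varifold_supp_def)
    have "0 < emeasure (weight V) (hball m x r \<inter> U')"
      using x r unfolding emeasure_weight_restrict[OF V U' B, symmetric]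
      by (simp add: varifold_supp_def)
    also have "\<dots> \<le> emeasure (weight V) (hball m x r)"
      using B by (intro emeasure_mono) (auto simp: weight_def)
    finally show ?thesis .
  qed
  then show "x \<in> varifold_supp m V"
    using x by (simp add: varifold_supp_def)
qed

lemma countably_rectifiable_subset:
  "countably_rectifiable n m M \<Longrightarrow> M' \<subseteq> M \<Longrightarrow> countably_rectifiable n m M'"
  unfolding countably_rectifiable_def by (meson order_trans)

text \<open>The witnesses are \<open>M \<inter> ?B\<close> and the same density. The ball must be
  Hausdorff-measurable for the new set to qualify, and tangent planes must be local for the
  representation formula to survive.\<close>

lemma integral_varifold_restrict:
  assumes n: "1 \<le> n" and p: "p \<in> hyp m" and r: "0 < r" and sub: "hball m p r \<subseteq> U"
    and V: "integral_varifold n m U V"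
  shows "integral_varifold n m (hball m p r) (restrict_space V (grassmann n m (hball m p r)))"
proof -
  let ?B = "hball m p r"
  obtain M and \<theta> :: "(nat \<Rightarrow> real) \<Rightarrow> nat" where sV: "sets V = sets (grassmann_borel n m U)"
    and M: "M \<subseteq> U" "M \<in> sets (hausdorff n m)" "countably_rectifiable n m M"
    and \<theta>: "\<theta> \<in> restrict_space (hausdorff n m) M \<rightarrow>\<^sub>M count_space UNIV" "\<forall>x\<in>M. 1 \<le> \<theta> x"
    and fin: "\<forall>K. compact K \<longrightarrow> K \<subseteq> U \<longrightarrow> (\<integral>\<^sup>+x\<in>M \<inter> K. of_nat (\<theta> x) \<partial>hausdorff n m) < \<infinity>"
    and eq: "\<forall>A\<in>sets (grassmann_borel n m U). emeasure V A =
             (\<integral>\<^sup>+x\<in>{x \<in> M. (x, approx_tangent n m M x) \<in> A}. of_nat (\<theta> x) \<partial>hausdorff n m)"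
    using V unfolding integral_varifold_def by (elim conjE exE) (rule that)
  note B = sub hball_borel[OF p r]
  show ?thesis
    unfolding integral_varifold_def
  proof (intro conjI exI[of _ "M \<inter> ?B"] exI[of _ \<theta>] ballI allI impI)
    show "sets (restrict_space V (grassmann n m ?B)) = sets (grassmann_borel n m ?B)"
      by (rule sets_restrict_varifold[OF sV B])
    show "M \<inter> ?B \<in> sets (hausdorff n m)"
      using M hball_hausdorff[OF n p] by (intro sets.Int)
    show "countably_rectifiable n m (M \<inter> ?B)"
      using M(3) by (rule countably_rectifiable_subset) simp
    show "\<theta> \<in> restrict_space (hausdorff n m) (M \<inter> ?B) \<rightarrow>\<^sub>M count_space UNIV"
      by (rule measurable_restrict_mono[OF \<theta>(1)]) simp
    show "1 \<le> \<theta> x" if "x \<in> M \<inter> ?B" for x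
      using that \<theta>(2) by simp
    show "(\<integral>\<^sup>+x\<in>M \<inter> ?B \<inter> K. of_nat (\<theta> x) \<partial>hausdorff n m) < \<infinity>" if K: "compact K" "K \<subseteq> ?B" for K
    proof -
      have "M \<inter> ?B \<inter> K = M \<inter> K" using K by auto
      then show ?thesis using fin K sub by auto
    qed
    fix A assume A: "A \<in> sets (grassmann_borel n m ?B)"
    have AG: "A \<subseteq> grassmann n m ?B"
      using sets.sets_into_space[OF A] by simp
    have "A \<in> sets V"
      using A sets_restrict_varifold[OF sV B] grassmann_sets[OF sV B]
      by (metis sets_restrict_space_iff sets.Int_space_eq2)
    then have "emeasure (restrict_space V (grassmann n m ?B)) A =
        (\<integral>\<^sup>+x\<in>{x \<in> M. (x, approx_tangent n m M x) \<in> A}. of_nat (\<theta> x) \<partial>hausdorff n m)"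
      using emeasure_restrict_varifold[OF sV B AG] eq sV by simp
    \<comment> \<open>\<open>A\<close> lies over the ball, so its base points are automatically in
      \<open>?B\<close>, where both tangent cones agree.\<close>
    also have "{x \<in> M. (x, approx_tangent n m M x) \<in> A} =
        {x \<in> M \<inter> ?B. (x, approx_tangent n m (M \<inter> ?B) x) \<in> A}"
      using AG approx_tangent_Int_hball[OF p] by (auto simp: grassmann_def)
    finally show "emeasure (restrict_space V (grassmann n m ?B)) A =
        (\<integral>\<^sup>+x\<in>{x \<in> M \<inter> ?B. (x, approx_tangent n m (M \<inter> ?B) x) \<in> A}. of_nat (\<theta> x) \<partial>hausdorff n m)" .
  qed simp
qed

section \<open>Locality of the divergence and stationarity of restrictions\<close>

lemma lift_hyp:
  assumes "y \<in> topspace (Euclidean_space (Suc m))"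
  shows "lift m y \<in> hyp m"
proof -
  have "0 < 1 + (\<Sum>j=1..m. (y j)\<^sup>2)"
    by (intro add_pos_nonneg sum_nonneg) auto
  then show ?thesis
    using assms by (auto simp: hyp_def lift_def topspace_Euclidean_space lor_self)
qed

lemma lift_of_hyp: "x \<in> hyp m \<Longrightarrow> lift m x = x"
  using hyp_time[of x m] by (auto simp: lift_def hyp_def)

text \<open>The complement of a compact set is open, so the curve used in \<open>cov_deriv\<close>
  stays outside \<open>K\<close> for small times. The field vanishes along that piece, and with it
  every derivative at time zero.\<close>

lemma divergence_eq_0:
  assumes K: "compact K" "\<And>x. x \<in> hyp m - K \<Longrightarrow> X x = (\<lambda>_. 0)"
    and x: "x \<in> hyp m - K" and S: "(x, S) \<in> grassmann n m U"
  shows "divergence n m X x S = 0"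
proof -
  \<comment> \<open>Membership of \<open>(x, S)\<close> in the bundle guarantees that a frame
    exists, so the choice returns tangent vectors.\<close>
  define e where "e = (SOME e. orthonormal_frame n m x e \<and> S = frame_span n e)"
  have e: "orthonormal_frame n m x e"
    using S someI_ex[of "\<lambda>e. orthonormal_frame n m x e \<and> S = frame_span n e"]
    by (auto simp: grassmann_def e_def)
  have "cov_deriv m X x v = (\<lambda>_. 0)" if v: "v \<in> tangent m x" for v
  proof -
    define \<gamma> where "\<gamma> t = lift m (\<lambda>i. x i + t * v i)" for t :: real
    have "continuous_on UNIV \<gamma>"
      unfolding \<gamma>_def lift_def
    proof (rule continuous_on_coordinatewise_then_product)
      show "continuous_on UNIV (\<lambda>t. if i = 0 then sqrt (1 + (\<Sum>j=1..m. (x j + t * v j)\<^sup>2)) else x i + t * v i)" for i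
        by (cases "i = 0") (auto intro!: continuous_intros)
    qed
    then have "open (\<gamma> -` (- K))"
      using K(1) by (intro open_vimage open_Compl compact_imp_closed)
    moreover have "0 \<in> \<gamma> -` (- K)"
      using x by (simp add: \<gamma>_def lift_of_hyp)
    ultimately have "\<forall>\<^sub>F t in nhds 0. \<gamma> t \<in> - K"
      unfolding eventually_nhds by (intro exI[of _ "\<gamma> -` (- K)"]) simp
    moreover have "\<gamma> t \<in> hyp m" for t
      using x v unfolding \<gamma>_def
      by (intro lift_hyp) (auto simp: hyp_def tangent_def topspace_Euclidean_space)
    ultimately have ev: "\<forall>\<^sub>F t in nhds 0. X (\<gamma> t) j = 0" for j
      using K(2) by (auto elim!: eventually_mono)
    have "deriv (\<lambda>t. X (\<gamma> t) j) 0 = 0" for j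
      using deriv_cong_ev[OF ev refl, of j] by simp
    then show ?thesis
      by (simp add: cov_deriv_def \<gamma>_def)
  qed
  then show ?thesis
    using e unfolding divergence_def Let_def e_def[symmetric] by (simp add: orthonormal_frame_def)
qed

text \<open>A test field on \<open>U'\<close> is also one on \<open>U\<close>. Its divergence
  vanishes outside the bundle over \<open>U'\<close>, so inserting the indicator of that bundle
  leaves the integral unchanged.\<close>

lemma stationary_restrict:
  assumes V: "sets V = sets (grassmann_borel n m U)" and U': "U' \<subseteq> U" "U' \<in> sets borel"
    and U: "U \<subseteq> hyp m" and stat: "stationary n m U V"
  shows "stationary n m U' (restrict_space V (grassmann n m U'))"
  unfolding stationary_def
proof (intro allI impI)
  fix X assume X: "C1c_field m U' X"
  then obtain K where K: "compact K" "K \<subseteq> U'" "\<And>x. x \<in> hyp m - K \<Longrightarrow> X x = (\<lambda>_. 0)"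
    unfolding C1c_field_def by blast
  have G: "grassmann n m U' \<inter> space V \<in> sets V"
    using grassmann_sets[OF V U'] by auto
  have "C1c_field m U X"
    using X U' unfolding C1c_field_def by (meson order_trans)
  then have "0 = (\<integral>(x, S). divergence n m X x S \<partial>V)"
    using stat by (simp add: stationary_def)
  also have "\<dots> = (\<integral>z. indicator (grassmann n m U') z *\<^sub>R (case z of (x, S) \<Rightarrow> divergence n m X x S) \<partial>V)"
  proof (intro Bochner_Integration.integral_cong refl)
    fix z assume "z \<in> space V"
    then obtain x S where z: "z = (x, S)" "(x, S) \<in> grassmann n m U"
      by (cases z) (auto simp: space_varifold[OF V])
    show "(case z of (x, S) \<Rightarrow> divergence n m X x S) =
        indicator (grassmann n m U') z *\<^sub>R (case z of (x, S) \<Rightarrow> divergence n m X x S)"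
    proof (cases "x \<in> U'")
      case True
      then show ?thesis using z by (simp add: grassmann_def)
    next
      case False
      then have "x \<in> hyp m - K" using z K U by (auto simp: grassmann_def)
      then show ?thesis using divergence_eq_0[OF K(1,3) _ z(2)] z(1) by simp
    qed
  qed
  also have "\<dots> = (\<integral>(x, S). divergence n m X x S \<partial>restrict_space V (grassmann n m U'))"
    by (rule integral_restrict_space[OF G, symmetric])
  finally show "(\<integral>(x, S). divergence n m X x S \<partial>restrict_space V (grassmann n m U')) = 0"
    by simp
qed

section \<open>The comparison between radii 1 and 1/2\<close>

theorem corollary1p4:
  fixes n :: nat and \<epsilon>D CD :: real
  assumes "2 \<le> n" and "0 < \<epsilon>D" and "fixed_scale_comparison n \<epsilon>D CD"
  shows "\<exists>\<epsilon>. 0 < \<epsilon> \<and> \<epsilon> \<le> \<epsilon>D \<and>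
    (\<forall>k m q L V. 1 \<le> k \<longrightarrow> m = n + k \<longrightarrow> q \<in> hyp m \<longrightarrow> totally_geodesic n m L \<longrightarrow>
       integral_varifold n m (hball m q 2) V \<longrightarrow>
       hsetdist m q L < \<epsilon> \<longrightarrow>
       stationary n m (hball m q 2) V \<longrightarrow>
       varifold_supp m V \<inter> hball m q 2 \<subseteq> {x \<in> hyp m. hsetdist m x L < \<epsilon>} \<longrightarrow>
       emeasure (weight V) (hball m q 1) \<le> ennreal CD * emeasure (weight V) (hball m q (1/2)))"
proof (intro exI[of _ "min \<epsilon>D (1/4)"] conjI allI impI)
  \<comment> \<open>The bound \<open>1/4\<close> is the slack in both outer inclusions:
    \<open>5/4 - 1\<close> for the large balls and \<open>1/2 - 1/4\<close> for the small ones. It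
    also fits into \<open>2 - 3/2\<close>.\<close>
  show "0 < min \<epsilon>D (1/4)" "min \<epsilon>D (1/4) \<le> \<epsilon>D"
    using assms(2) by auto
  fix k m q L V
  assume k: "1 \<le> k" "m = n + k" and q: "q \<in> hyp m" and L: "totally_geodesic n m L"
    and V: "integral_varifold n m (hball m q 2) V"
    and qL: "hsetdist m q L < min \<epsilon>D (1/4)"
    and stat: "stationary n m (hball m q 2) V"
    and supp: "varifold_supp m V \<inter> hball m q 2 \<subseteq> {x \<in> hyp m. hsetdist m x L < min \<epsilon>D (1/4)}"
  \<comment> \<open>An infimum over an empty set of reals carries no information, so
    \<open>L\<close> must be seen to be nonempty before a near point can be extracted. The isometry
    carries the base point of \<open>hyp n\<close> into \<open>L\<close>.\<close>
  have "(\<lambda>i. if i = 0 then 1 else 0) \<in> hyp n"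
    by (auto simp: hyp_def topspace_Euclidean_space lor_def)
  then have "L \<noteq> {}"
    using L by (auto simp: totally_geodesic_def bij_betw_def)
  then obtain p where p: "p \<in> L" "hdist m q p < 1/4"
    using qL cInf_lessD[of "hdist m q ` L" "1/4"] by (auto simp: hsetdist_def)
  then have pm: "p \<in> hyp m"
    using L by (auto simp: totally_geodesic_def)
  have pq: "hdist m p q < 1/4"
    using p by (simp add: hdist_commute)
  let ?B = "hball m p (3/2)"
  let ?W = "restrict_space V (grassmann n m ?B)"
  have sub: "?B \<subseteq> hball m q 2" and sub1: "hball m q 1 \<subseteq> hball m p (5/4)"
    and sub2: "hball m p (1/4) \<subseteq> hball m q (1/2)"
    using p pq by (auto intro!: hball_subset[OF q pm] hball_subset[OF pm q])
  have sV: "sets V = sets (grassmann_borel n m (hball m q 2))"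
    using V by (simp add: integral_varifold_def)
  have B: "?B \<in> sets borel"
    using pm by (rule hball_borel) simp
  \<comment> \<open>Concentric balls inside \<open>?B\<close> do not notice the restriction; this is
    used for the radii \<open>5/4\<close> and \<open>1/4\<close>.\<close>
  have W: "emeasure (weight ?W) (hball m p s) = emeasure (weight V) (hball m p s)"
    if s: "0 < s" "s \<le> 3/2" for s
  proof -
    have "hball m p s \<inter> ?B = hball m p s"
      using s by (auto simp: hball_def)
    then show ?thesis
      using emeasure_weight_restrict[OF sV sub B hball_borel[OF pm s(1)]] by simp
  qed
  have "integral_varifold n m ?B ?W"
    using assms(1) by (intro integral_varifold_restrict[OF _ pm _ sub V]) auto
  moreover have "stationary n m ?B ?W"
    by (rule stationary_restrict[OF sV sub B _ stat]) (auto simp: hball_def)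
  moreover have "varifold_supp m ?W \<inter> ?B \<subseteq> {x \<in> hyp m. hsetdist m x L < \<epsilon>D}"
    using varifold_supp_restrict[OF sV sub B] supp sub by fastforce
  ultimately have comp: "emeasure (weight ?W) (hball m p (5/4)) \<le> ennreal CD * emeasure (weight ?W) (hball m p (1/4))"
    using assms(3) k L p(1) unfolding fixed_scale_comparison_def by blast
  have mono: "emeasure (weight V) (hball m a s) \<le> emeasure (weight V) (hball m b t)"
    if "hball m a s \<subseteq> hball m b t" "b \<in> hyp m" "0 < t" for a b s t
    using that by (intro emeasure_mono) (auto simp: weight_def intro: hball_borel)
  have "emeasure (weight V) (hball m q 1) \<le> emeasure (weight V) (hball m p (5/4))"
    using sub1 pm by (intro mono) auto
  also have "\<dots> \<le> ennreal CD * emeasure (weight V) (hball m p (1/4))"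
    using comp by (simp add: W)
  also have "\<dots> \<le> ennreal CD * emeasure (weight V) (hball m q (1/2))"
    using sub2 q by (intro mult_left_mono mono) auto
  finally show "emeasure (weight V) (hball m q 1) \<le> ennreal CD * emeasure (weight V) (hball m q (1/2))" .
qed

end
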